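(* Let $d\ge 2$ be an integer, and consider $\mathbb{C}^d\otimes\mathbb{C}^d\otimes\mathbb{C}^d\otimes\mathbb{C}^d$. Let $|\alpha_0\rangle=|0000\rangle$ and let $\{|\alpha_j\rangle\}_{j=1}^{d^3}$ be an enumeration of $\mathcal{B}_1\cup\mathcal{B}_2\cup\cdots\cup\mathcal{B}_9$, with $|\alpha_1\rangle=|1000\rangle$, $|\alpha_2\rangle=|0001\rangle$, $|\alpha_3\rangle=|0010\rangle$, $|\alpha_4\rangle=|0100\rangle$, where \begin{itemize} \item $\mathcal{B}_1=\{|1000\rangle,\ |0001\rangle,\ |0010\rangle,\ |0100\rangle\}$; \item $\mathcal{B}_2=\{\tfrac{1}{\sqrt2}(|0,j,i,0\rangle+|i,0,0,j\rangle): 1\le i,j\le d-1\}$; \item $\mathcal{B}_3=\{\tfrac{1}{\sqrt2}(|0,i,0,j\rangle+|i,0,j,0\rangle): 1\le i,j\le d-1\}$; \item $\mathcal{B}_4=\{\tfrac{1}{\sqrt2}(|0,0,i,j\rangle+|i,j,0,0\rangle): 1\le i,j\le d-1\}$; \item $\mathcal{B}_5=\{\tfrac{1}{\sqrt2}(|0,0,0,i\rangle+|i-1,i-1,i-1,0\rangle): 2\le i\le d-1\}$; \item $\mathcal{B}_6=\{\tfrac{1}{\sqrt2}(|0,0,i,0\rangle+|i-1,i-1,0,i-1\rangle): 2\le i\le d-1\}$; \item $\mathcal{B}_7=\{\tfrac{1}{\sqrt2}(|0,i,0,0\rangle+|i-1,0,i-1,i-1\rangle): 2\le i\le d-1\}$;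 \item $\mathcal{B}_8=\{\tfrac{1}{\sqrt2}(|0,i-1,i-1,i-1\rangle+|i,0,0,0\rangle): 2\le i\le d-1\}$; \item $\mathcal{B}_9=\{\tfrac12(|0,i,j,k\rangle+|i,j,k,0\rangle+|j,k,0,i\rangle+|k,0,i,j\rangle): 1\le i,j,k\le d-1,\ (i,j,k)\notin\{(m,m,m):1\le m\le d-2\}\}$. \end{itemize} Define $|\psi_0\rangle=|\alpha_0\rangle$ and $|\psi_i\rangle=\sum_{j=1}^{d^3}\omega_{d^3}^{ij}|\alpha_j\rangle$ for $1\le i\le d^3$. Then $\{|\psi_i\rangle\}_{i=0}^{d^3}$ is a strongest nonlocal set of size $d^3+1$.
   Context: $\omega_n=e^{2\pi\sqrt{-1}/n}$. $\{|0\rangle,\dots,|d-1\rangle\}$ is the computational (orthonormal) basis of $\mathbb{C}^d$, and $|a,b,c,e\rangle=|abce\rangle=|a\rangle\otimes|b\rangle\otimes|c\rangle\otimes|e\rangle$; the four tensor factors belong to parties $A$, $B$, $C$, $D$. Families with an empty index range are empty. States need not be normalized. A POVM on a Hilbert space $\mathcal{H}$ is a set of positive semidefinite operators $\{E_m=M_m^\dagger M_m\}$ with $\sum_m E_m=I_{\mathcal{H}}$; it is trivial if every $E_m$ is proportional to $I_{\mathcal{H}}$. Given a set $\{|\psi_i\rangle\}$ of mutually orthogonal multipartite states and a subset $X$ of the parties with complement $\overline{X}$, a POVM $\{E_m\}$ on the joint space of the parties in $X$ is an orthogonality-preserving local measurement (OPLM) if the post-measurement states stay mutually orthogonal, i.e.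 $\langle\psi_i|\,(I_{\overline{X}}\otimes E_m)\,|\psi_j\rangle=0$ for all $i\ne j$ and all $m$. A set of mutually orthogonal multipartite states is strongest nonlocal if, for every bipartition $X|\overline{X}$ of the parties (both sides nonempty), the only OPLMs on either side are trivial. (Equivalently: for every single party, the only OPLMs performed jointly by all the other parties are trivial.) *)

theory Defs
  imports Complex_Main "HOL-Library.FuncSet"
begin

section \<open>Multipartite states and operators\<close>

text \<open>
  The parties are the elements of a finite type \<open>'p\<close>, each with local space \<open>\<complex>\<^sup>d\<close>. For a set \<open>X\<close> of
  parties, the computational basis of the joint space of the parties in \<open>X\<close> is labelled by the
  functions assigning to each party in \<open>X\<close> a number below \<open>d\<close>; following \<open>PiE\<close>, a label is
  \<open>undefined\<close> on parties outside \<open>X\<close>. Vectors are coordinate functions on labels and operators are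
  matrices in the computational basis; only the entries at labels in \<open>labels d X\<close> matter, and
  vectors are required to be zero elsewhere so that equality of functions is equality of vectors.
\<close>

type_synonym 'p label = "'p \<Rightarrow> nat"
type_synonym 'p vect = "'p label \<Rightarrow> complex"
type_synonym 'p operator = "'p label \<Rightarrow> 'p label \<Rightarrow> complex"

definition labels :: "nat \<Rightarrow> 'p set \<Rightarrow> 'p label set" where
  "labels d X = (\<Pi>\<^sub>E p\<in>X. {..<d})"

definition vectors :: "nat \<Rightarrow> 'p set \<Rightarrow> 'p vect set" where
  "vectors d X = {v. \<forall>x. x \<notin> labels d X \<longrightarrow> v x = 0}"

definition braket :: "nat \<Rightarrow> 'p set \<Rightarrow> 'p vect \<Rightarrow> 'p vect \<Rightarrow> complex" where
  "braket d X u v = (\<Sum>x\<in>labels d X. cnj (u x) * v x)"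

definition apply_op :: "nat \<Rightarrow> 'p set \<Rightarrow> 'p operator \<Rightarrow> 'p vect \<Rightarrow> 'p vect" where
  "apply_op d X E v = (\<lambda>x. if x \<in> labels d X then \<Sum>y\<in>labels d X. E x y * v y else 0)"

definition psd :: "nat \<Rightarrow> 'p set \<Rightarrow> 'p operator \<Rightarrow> bool" where
  "psd d X E \<longleftrightarrow> (\<forall>v\<in>vectors d X.
     braket d X v (apply_op d X E v) \<in> \<real> \<and> 0 \<le> Re (braket d X v (apply_op d X E v)))"

text \<open>
  A POVM with outcomes \<open>0, \<dots>, k - 1\<close>. In finite dimension the positive semidefinite operators are
  exactly those of the form \<open>M\<^sup>\<dagger> M\<close>, so the measurement operators are not mentioned separately.
\<close>

definition povm :: "nat \<Rightarrow> 'p set \<Rightarrow> nat \<Rightarrow> (nat \<Rightarrow> 'p operator) \<Rightarrow> bool" where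
  "povm d X k E \<longleftrightarrow> (\<forall>m<k. psd d X (E m)) \<and>
     (\<forall>x\<in>labels d X. \<forall>y\<in>labels d X. (\<Sum>m<k. E m x y) = of_bool (x = y))"

definition trivial_povm :: "nat \<Rightarrow> 'p set \<Rightarrow> nat \<Rightarrow> (nat \<Rightarrow> 'p operator) \<Rightarrow> bool" where
  "trivial_povm d X k E \<longleftrightarrow>
     (\<forall>m<k. \<exists>c. \<forall>x\<in>labels d X. \<forall>y\<in>labels d X. E m x y = c * of_bool (x = y))"

text \<open>The operator \<open>I \<otimes> E\<close> on the joint space of all parties, for \<open>E\<close> acting on the parties in \<open>X\<close>:\<close>

definition extend_op :: "'p set \<Rightarrow> 'p operator \<Rightarrow> 'p operator" where
  "extend_op X E = (\<lambda>x y. of_bool (restrict x (- X) = restrict y (- X)) *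
     E (restrict x X) (restrict y X))"

definition mutually_orthogonal :: "nat \<Rightarrow> 'p vect set \<Rightarrow> bool" where
  "mutually_orthogonal d S \<longleftrightarrow> pairwise (\<lambda>u v. braket d UNIV u v = 0) S"

definition oplm :: "nat \<Rightarrow> 'p vect set \<Rightarrow> 'p set \<Rightarrow> nat \<Rightarrow> (nat \<Rightarrow> 'p operator) \<Rightarrow> bool" where
  "oplm d S X k E \<longleftrightarrow> povm d X k E \<and>
     (\<forall>m<k. pairwise (\<lambda>u v. braket d UNIV u (apply_op d UNIV (extend_op X (E m)) v) = 0) S)"

definition strongest_nonlocal :: "nat \<Rightarrow> ('p::finite) vect set \<Rightarrow> bool" where
  "strongest_nonlocal d S \<longleftrightarrow>
     S \<subseteq> vectors d UNIV - {\<lambda>_. 0} \<and> mutually_orthogonal d S \<and>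
     (\<forall>X. X \<noteq> {} \<and> - X \<noteq> {} \<longrightarrow>
        (\<forall>Y\<in>{X, - X}. \<forall>k E. oplm d S Y k E \<longrightarrow> trivial_povm d Y k E))"


section \<open>The four-party family\<close>

datatype party = PartyA | PartyB | PartyC | PartyD

lemma UNIV_party: "UNIV = {PartyA, PartyB, PartyC, PartyD}"
  by (auto intro: party.exhaust)

instance party :: finite
  by standard (simp add: UNIV_party)

definition ket :: "nat \<Rightarrow> nat \<Rightarrow> nat \<Rightarrow> nat \<Rightarrow> party vect" where
  "ket a b c e = (\<lambda>x. of_bool (x = case_party a b c e))"

definition sup2 :: "party vect \<Rightarrow> party vect \<Rightarrow> party vect" where
  "sup2 u v = (\<lambda>x. (u x + v x) / complex_of_real (sqrt 2))"

definition sup4 :: "party vect \<Rightarrow> party vect \<Rightarrow> party vect \<Rightarrow> party vect \<Rightarrow> party vect" where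
  "sup4 u v w z = (\<lambda>x. (u x + v x + w x + z x) / 2)"

definition B1 :: "party vect set" where
  "B1 = {ket 1 0 0 0, ket 0 0 0 1, ket 0 0 1 0, ket 0 1 0 0}"

definition B2 :: "nat \<Rightarrow> party vect set" where
  "B2 d = {sup2 (ket 0 j i 0) (ket i 0 0 j) | i j. i \<in> {1..d-1} \<and> j \<in> {1..d-1}}"

definition B3 :: "nat \<Rightarrow> party vect set" where
  "B3 d = {sup2 (ket 0 i 0 j) (ket i 0 j 0) | i j. i \<in> {1..d-1} \<and> j \<in> {1..d-1}}"

definition B4 :: "nat \<Rightarrow> party vect set" where
  "B4 d = {sup2 (ket 0 0 i j) (ket i j 0 0) | i j. i \<in> {1..d-1} \<and> j \<in> {1..d-1}}"

definition B5 :: "nat \<Rightarrow> party vect set" where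
  "B5 d = {sup2 (ket 0 0 0 i) (ket (i-1) (i-1) (i-1) 0) | i. i \<in> {2..d-1}}"

definition B6 :: "nat \<Rightarrow> party vect set" where
  "B6 d = {sup2 (ket 0 0 i 0) (ket (i-1) (i-1) 0 (i-1)) | i. i \<in> {2..d-1}}"

definition B7 :: "nat \<Rightarrow> party vect set" where
  "B7 d = {sup2 (ket 0 i 0 0) (ket (i-1) 0 (i-1) (i-1)) | i. i \<in> {2..d-1}}"

definition B8 :: "nat \<Rightarrow> party vect set" where
  "B8 d = {sup2 (ket 0 (i-1) (i-1) (i-1)) (ket i 0 0 0) | i. i \<in> {2..d-1}}"

definition B9 :: "nat \<Rightarrow> party vect set" where
  "B9 d = {sup4 (ket 0 i j k) (ket i j k 0) (ket j k 0 i) (ket k 0 i j) | i j k.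
     i \<in> {1..d-1} \<and> j \<in> {1..d-1} \<and> k \<in> {1..d-1} \<and> (i, j, k) \<notin> {(m, m, m) | m. m \<in> {1..d-2}}}"

definition B_all :: "nat \<Rightarrow> party vect set" where
  "B_all d = B1 \<union> B2 d \<union> B3 d \<union> B4 d \<union> B5 d \<union> B6 d \<union> B7 d \<union> B8 d \<union> B9 d"

definition omega :: "nat \<Rightarrow> complex" where
  "omega n = exp (2 * of_real pi * \<i> / of_nat n)"

definition psi :: "nat \<Rightarrow> (nat \<Rightarrow> party vect) \<Rightarrow> nat \<Rightarrow> party vect" where
  "psi d \<alpha> i = (if i = 0 then \<alpha> 0
     else (\<lambda>x. \<Sum>j=1..d^3. omega (d^3) ^ (i * j) * \<alpha> j x))"

end

theory Submission
  imports Defs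
begin

text \<open>
  Up to normalisation each \<open>\<alpha> j\<close> is the indicator of a cell of labels, and the cells partition the
  nonzero labels that contain a \<open>0\<close>. Let \<open>T = I \<otimes> E\<close> act trivially on a party \<open>p\<close>, where \<open>E\<close> is an
  element of an OPLM. Orthogonality to \<open>psi 0\<close> gives \<open>T 0 w = 0\<close> for all \<open>w \<noteq> 0\<close>, since a cell has
  at most one label that is \<open>0\<close> at \<open>p\<close>. As \<open>T\<close> ignores the value at \<open>p\<close>, also the row of
  \<open>\<langle>\<alpha> j|T|\<alpha> k\<rangle>\<close> that belongs to the unit label at \<open>p\<close> vanishes off the diagonal. This matrix is
  circulant, being diagonal in the Fourier basis, so it is a multiple \<open>c\<close> of the identity. Finally,
  \<open>T x y = c \<cdot> \<delta>\<close> follows for labels \<open>x\<close>, \<open>y\<close> that are \<open>0\<close> at \<open>p\<close> by induction: the entry of the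
  matrix at the cells of \<open>x\<close> and \<open>y\<close> is \<open>T x y\<close> plus terms which, after setting the value at \<open>p\<close>
  to \<open>0\<close>, are of lower rank.
\<close>

section \<open>Fourier sums\<close>

lemma omega_cis: "omega n = cis (2 * pi / real n)"
  by (simp add: omega_def cis_conv_exp mult_ac)

lemma omega_power_cis: "omega n ^ k = cis (2 * pi * real k / real n)"
  by (simp add: omega_cis DeMoivre mult_ac)

lemma omega_nonzero [simp]: "omega n \<noteq> 0"
  by (simp add: omega_cis)

lemma cnj_omega: "cnj (omega n) = inverse (omega n)"
  by (simp add: omega_cis cis_cnj)

lemma omega_power_self: "n > 0 \<Longrightarrow> omega n ^ n = 1"
  by (simp add: omega_power_cis)

lemma omega_power_root:
  assumes "n > 0"
  shows "(omega n ^ k) ^ n = 1"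
proof -
  have "(omega n ^ k) ^ n = (omega n ^ n) ^ k"
    by (simp only: mult.commute flip: power_mult)
  then show ?thesis using assms by (simp add: omega_power_self)
qed

text \<open>\<open>bij_betw_roots_unity\<close> enumerates the roots with exponents in
  \<open>{..<n}\<close>, whereas the states use \<open>{1..n}\<close>. Only \<open>k - j\<close> is
  compared with \<open>0\<close>, and it lies below \<open>n\<close> because
  \<open>j \<ge> 1\<close>.\<close>

lemma inj_on_omega_power:
  assumes "n > 0"
  shows "inj_on (\<lambda>k. omega n ^ k) {1..n}"
proof -
  have key: "j = k" if "j \<le> k" "j \<ge> 1" "k \<le> n" "omega n ^ j = omega n ^ k" for j k
  proof -
    have "omega n ^ k = omega n ^ j * omega n ^ (k - j)"
      using that(1) by (simp flip: power_add)
    then have "omega n ^ (k - j) = omega n ^ 0"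
      using that(4) by simp
    then have "k - j = 0"
      using bij_betw_roots_unity[OF assms] that assms
      unfolding omega_power_cis bij_betw_def
      by (intro inj_onD[of "\<lambda>k. cis (2 * pi * real k / real n)" "{..<n}"]) auto
    then show ?thesis using that(1) by simp
  qed
  show ?thesis
    by (rule inj_onI) (metis key atLeastAtMost_iff linear)
qed

text \<open>Replaces modular arithmetic on indices: a root of unity is turned back into an index,
  and the root \<open>1\<close> gets exponent \<open>n\<close> in place of \<open>0\<close>.\<close>

lemma root_of_unity_omega:
  assumes "n > 0" "z ^ n = 1"
  obtains k where "k \<in> {1..n}" "omega n ^ k = z"
proof -
  have "z \<in> (\<lambda>k. cis (2 * pi * real k / real n)) ` {..<n}"
    using bij_betw_imp_surj_on[OF bij_betw_roots_unity[OF assms(1)]] assms(2) by simp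
  then obtain k where k: "k < n" "omega n ^ k = z"
    by (auto simp: omega_power_cis)
  show ?thesis
  proof (cases "k = 0")
    case True
    then show ?thesis using that[of n] k assms(1) by (simp add: omega_power_self)
  next
    case False
    then show ?thesis using that[of k] k by simp
  qed
qed

lemma sum_powers_root_of_unity:
  fixes z :: complex
  assumes "z ^ n = 1" "z \<noteq> 1"
  shows "(\<Sum>i=1..n. z ^ i) = 0"
proof -
  have "(\<Sum>i=1..n. z ^ i) = z * (\<Sum>i<n. z ^ i)"
    by (simp add: sum_distrib_left sum.atLeast1_atMost_eq)
  also have "(\<Sum>i<n. z ^ i) = 0"
    using assms by (simp add: geometric_sum)
  finally show ?thesis by simp
qed

text \<open>The summand is the \<open>i\<close>-th power of one root of unity \<open>z\<close>,
  which equals \<open>1\<close> exactly for \<open>j = k\<close>; otherwise the geometric sum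
  vanishes.\<close>

lemma omega_orthogonality:
  assumes "n > 0" "j \<in> {1..n}" "k \<in> {1..n}"
  shows "(\<Sum>i=1..n. cnj (omega n ^ (i * j)) * omega n ^ (i * k)) = of_nat n * of_bool (j = k)"
proof -
  define z where "z = cnj (omega n ^ j) * omega n ^ k"
  have zi: "cnj (omega n ^ (i * j)) * omega n ^ (i * k) = z ^ i" for i
    by (simp add: z_def power_mult_distrib mult.commute[of i] flip: power_mult)
  have zn: "z ^ n = 1"
    using assms(1) by (simp add: z_def power_mult_distrib omega_power_root del: complex_cnj_power flip: complex_cnj_power)
  have z1: "z = 1 \<longleftrightarrow> j = k"
    using inj_onD[OF inj_on_omega_power[OF assms(1)] _ assms(2,3)]
    by (auto simp: z_def cnj_omega power_inverse field_simps)
  show ?thesis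
    unfolding zi using sum_powers_root_of_unity[OF zn] z1 by auto
qed

lemma omega_orthogonality_transposed:
  assumes "n > 0" "j \<in> {1..n}" "k \<in> {1..n}"
  shows "(\<Sum>i=1..n. cnj (omega n ^ (j * i)) * omega n ^ (k * i)) = of_nat n * of_bool (j = k)"
  using omega_orthogonality[OF assms] by (simp add: mult.commute)

lemma fourier_inversion:
  assumes n: "n > 0" and k: "k \<in> {1..n}"
  shows "(\<Sum>l=1..n. cnj (omega n ^ (l * k)) * (\<Sum>k'=1..n. omega n ^ (l * k') * f k')) = of_nat n * f k"
proof -
  have "(\<Sum>l=1..n. cnj (omega n ^ (l * k)) * (\<Sum>k'=1..n. omega n ^ (l * k') * f k'))
      = (\<Sum>k'=1..n. (\<Sum>l=1..n. cnj (omega n ^ (l * k)) * omega n ^ (l * k')) * f k')"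
    unfolding sum_distrib_left sum_distrib_right
    by (subst sum.swap) (simp add: mult.assoc)
  also have "\<dots> = (\<Sum>k'=1..n. of_nat n * of_bool (k = k') * f k')"
    by (intro sum.cong refl) (simp only: omega_orthogonality[OF n k])
  also have "\<dots> = (\<Sum>k'=1..n. if k' = k then of_nat n * f k' else 0)"
    by (intro sum.cong) auto
  also have "\<dots> = of_nat n * f k"
    using k by simp
  finally show ?thesis .
qed

text \<open>Serves to pass from orthogonality to all \<open>psi l\<close> with \<open>l > 0\<close>
  to orthogonality to every single \<open>\<alpha> k\<close>.\<close>

lemma fourier_kernel:
  assumes "n > 0" "\<And>l. l \<in> {1..n} \<Longrightarrow> (\<Sum>k=1..n. omega n ^ (l * k) * f k) = 0" "k \<in> {1..n}"
  shows "f k = 0"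
  using fourier_inversion[OF assms(1,3), of f] assms(1,2) by simp

text \<open>For states in the antilinear slot; conjugation reduces it to
  \<open>fourier_kernel\<close>.\<close>

lemma fourier_kernel_cnj:
  assumes "n > 0" "\<And>l. l \<in> {1..n} \<Longrightarrow> (\<Sum>k=1..n. cnj (omega n ^ (l * k)) * f k) = 0" "k \<in> {1..n}"
  shows "f k = 0"
proof -
  have "(\<Sum>k=1..n. omega n ^ (l * k) * cnj (f k)) = 0" if "l \<in> {1..n}" for l
    using arg_cong[OF assms(2)[OF that], of cnj] by (simp add: cnj_sum)
  from fourier_kernel[of n "\<lambda>k. cnj (f k)", OF assms(1) this assms(3)] show ?thesis by simp
qed

text \<open>A matrix that is diagonal in the Fourier basis is circulant, so all its rows are
  shifts of any single one.\<close>

lemma circulant_row: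
  fixes A :: "nat \<Rightarrow> nat \<Rightarrow> complex"
  assumes n: "n > 0"
    and diag: "\<And>i l. i \<in> {1..n} \<Longrightarrow> l \<in> {1..n} \<Longrightarrow> i \<noteq> l \<Longrightarrow>
      (\<Sum>j=1..n. \<Sum>k=1..n. cnj (omega n ^ (i * j)) * omega n ^ (l * k) * A j k) = 0"
    and r: "r \<in> {1..n}" "\<And>k. k \<in> {1..n} \<Longrightarrow> k \<noteq> r \<Longrightarrow> A r k = 0"
    and jk: "j \<in> {1..n}" "k \<in> {1..n}"
  shows "A j k = A r r * of_bool (j = k)"
proof -
  define M where "M i l = (\<Sum>j=1..n. \<Sum>k=1..n. cnj (omega n ^ (i * j)) * omega n ^ (l * k) * A j k)" for i l
  define z where "z j k = omega n ^ j * cnj (omega n ^ k)" for j k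
  have inner: "(\<Sum>l=1..n. cnj (omega n ^ (l * k)) * M i l) = of_nat n * (\<Sum>j=1..n. cnj (omega n ^ (i * j)) * A j k)"
    if "k \<in> {1..n}" for i k
  proof -
    have "M i l = (\<Sum>k'=1..n. omega n ^ (l * k') * (\<Sum>j=1..n. cnj (omega n ^ (i * j)) * A j k'))" for l
      unfolding M_def sum_distrib_left by (subst sum.swap) (simp add: mult_ac)
    then show ?thesis using fourier_inversion[OF n that] by simp
  qed
  \<comment> \<open>Inverting the transform in both indices leaves only the entries
    \<open>M i i\<close>, so \<open>A j k\<close> depends on \<open>j\<close> and \<open>k\<close>
    only through \<open>z j k\<close>, which is \<open>omega n\<close> to the power
    \<open>j - k\<close>.\<close>
  have circ: "of_nat n * (of_nat n * A j k) = (\<Sum>i=1..n. M i i * z j k ^ i)"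
    if jk: "j \<in> {1..n}" "k \<in> {1..n}" for j k
  proof -
    have "(\<Sum>i=1..n. omega n ^ (i * j) * (\<Sum>j'=1..n. cnj (omega n ^ (i * j')) * A j' k)) = of_nat n * A j k"
      using arg_cong[OF fourier_inversion[OF n jk(1), of "\<lambda>j. cnj (A j k)"], of cnj]
      by (simp add: cnj_sum)
    then have "of_nat n * (of_nat n * A j k)
      = (\<Sum>i=1..n. of_nat n * (omega n ^ (i * j) * (\<Sum>j'=1..n. cnj (omega n ^ (i * j')) * A j' k)))"
      by (simp only: flip: sum_distrib_left)
    also have "\<dots> = (\<Sum>i=1..n. omega n ^ (i * j) * (of_nat n * (\<Sum>j'=1..n. cnj (omega n ^ (i * j')) * A j' k)))"
      by (intro sum.cong refl) (rule mult.left_commute)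
    also have "\<dots> = (\<Sum>i=1..n. omega n ^ (i * j) * (\<Sum>l=1..n. cnj (omega n ^ (l * k)) * M i l))"
      by (simp only: inner[OF jk(2)])
    also have "\<dots> = (\<Sum>i=1..n. M i i * z j k ^ i)"
    proof (rule sum.cong[OF refl])
      fix i assume i: "i \<in> {1..n}"
      have "(\<Sum>l=1..n. cnj (omega n ^ (l * k)) * M i l) = (\<Sum>l=1..n. if l = i then cnj (omega n ^ (l * k)) * M i l else 0)"
        using diag[OF i] by (intro sum.cong refl) (auto simp: M_def)
      also have "\<dots> = cnj (omega n ^ (i * k)) * M i i" using i by simp
      finally show "omega n ^ (i * j) * (\<Sum>l=1..n. cnj (omega n ^ (l * k)) * M i l) = M i i * z j k ^ i"
        by (simp add: z_def power_mult_distrib mult.commute[of i] power_mult)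
    qed
    finally show ?thesis .
  qed
  \<comment> \<open>The index \<open>k'\<close> is \<open>r + k - j\<close> modulo \<open>n\<close>:
    the place in row \<open>r\<close> on the same circulant diagonal as
    \<open>(j, k)\<close>.\<close>
  have "(omega n ^ r * omega n ^ k * cnj (omega n ^ j)) ^ n = 1"
    using n by (simp add: power_mult_distrib omega_power_root del: complex_cnj_power flip: complex_cnj_power)
  then obtain k' where k': "k' \<in> {1..n}" "omega n ^ k' = omega n ^ r * omega n ^ k * cnj (omega n ^ j)"
    using root_of_unity_omega[OF n] by metis
  have "z j k = z r k'"
    by (simp add: z_def k' cnj_omega power_inverse field_simps)
  then have "A j k = A r k'"
    using circ[OF jk, symmetric] circ[OF r(1) k'(1)] n by (simp only: mult_cancel_left) simp
  moreover have "k' = r \<longleftrightarrow> j = k"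
  proof -
    have "k' = r \<longleftrightarrow> omega n ^ k' = omega n ^ r"
      using inj_on_omega_power[OF n] k'(1) r(1) by (metis inj_onD)
    also have "\<dots> \<longleftrightarrow> omega n ^ j = omega n ^ k"
      by (auto simp: k' cnj_omega power_inverse field_simps)
    also have "\<dots> \<longleftrightarrow> j = k"
      using inj_on_omega_power[OF n] jk by (metis inj_onD)
    finally show ?thesis .
  qed
  ultimately show ?thesis using r(2)[OF k'(1)] by auto
qed

section \<open>Cells of computational basis labels\<close>

abbreviation wd :: "nat \<Rightarrow> nat \<Rightarrow> nat \<Rightarrow> nat \<Rightarrow> party label" where
  "wd a b c e \<equiv> case_party a b c e"

lemma wd_eq_iff [simp]: "wd a b c e = wd a' b' c' e' \<longleftrightarrow> a = a' \<and> b = b' \<and> c = c' \<and> e = e'"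
  by (metis party.case)

lemma wd_expand: "w = wd (w PartyA) (w PartyB) (w PartyC) (w PartyD)"
  by (rule ext) (simp split: party.split)

lemma labels_UNIV_iff: "w \<in> labels d UNIV \<longleftrightarrow> (\<forall>p. w p < d)"
  by (auto simp: labels_def PiE_iff)

lemma wd_in_labels [simp]: "wd a b c e \<in> labels d UNIV \<longleftrightarrow> a < d \<and> b < d \<and> c < d \<and> e < d"
  by (auto simp: labels_UNIV_iff split: party.split)

text \<open>The rules list the supports of the states in \<open>B1\<close> to \<open>B9\<close>. Of
  the constant triples, \<open>b9\<close> keeps only the one with value \<open>d - 1\<close>; the
  smaller ones are covered by \<open>b8\<close>.\<close>

inductive_set cells :: "nat \<Rightarrow> party label set set" for d where
  b1a: "{wd 1 0 0 0} \<in> cells d"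
| b1d: "{wd 0 0 0 1} \<in> cells d"
| b1c: "{wd 0 0 1 0} \<in> cells d"
| b1b: "{wd 0 1 0 0} \<in> cells d"
| b2: "i \<in> {1..d-1} \<Longrightarrow> j \<in> {1..d-1} \<Longrightarrow> {wd 0 j i 0, wd i 0 0 j} \<in> cells d"
| b3: "i \<in> {1..d-1} \<Longrightarrow> j \<in> {1..d-1} \<Longrightarrow> {wd 0 i 0 j, wd i 0 j 0} \<in> cells d"
| b4: "i \<in> {1..d-1} \<Longrightarrow> j \<in> {1..d-1} \<Longrightarrow> {wd 0 0 i j, wd i j 0 0} \<in> cells d"
| b5: "i \<in> {2..d-1} \<Longrightarrow> {wd 0 0 0 i, wd (i-1) (i-1) (i-1) 0} \<in> cells d"
| b6: "i \<in> {2..d-1} \<Longrightarrow> {wd 0 0 i 0, wd (i-1) (i-1) 0 (i-1)} \<in> cells d"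
| b7: "i \<in> {2..d-1} \<Longrightarrow> {wd 0 i 0 0, wd (i-1) 0 (i-1) (i-1)} \<in> cells d"
| b8: "i \<in> {2..d-1} \<Longrightarrow> {wd 0 (i-1) (i-1) (i-1), wd i 0 0 0} \<in> cells d"
| b9: "i \<in> {1..d-1} \<Longrightarrow> j \<in> {1..d-1} \<Longrightarrow> k \<in> {1..d-1} \<Longrightarrow>
    \<not> (i = j \<and> j = k \<and> i + 1 < d) \<Longrightarrow>
    {wd 0 i j k, wd i j k 0, wd j k 0 i, wd k 0 i j} \<in> cells d"

text \<open>One formula for all three normalisations: cells of 1, 2 and 4 labels give the factors
  \<open>1\<close>, \<open>sqrt 2\<close> and \<open>2\<close>.\<close>

definition unif :: "party label set \<Rightarrow> party vect" where
  "unif S = (\<lambda>x. of_bool (x \<in> S) / complex_of_real (sqrt (card S)))"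

lemma unif_1: "unif {wd a b c e} = ket a b c e"
  by (rule ext) (simp add: unif_def ket_def)

lemma unif_2:
  assumes "wd a b c e \<noteq> wd a' b' c' e'"
  shows "unif {wd a b c e, wd a' b' c' e'} = sup2 (ket a b c e) (ket a' b' c' e')"
  using assms by (intro ext) (auto simp: unif_def sup2_def ket_def)

text \<open>Positivity puts the only \<open>0\<close> of each label at a different party, so the
  four labels are distinct and the cell really has four elements.\<close>

lemma unif_4:
  assumes "i > 0" "j > 0" "k > 0"
  shows "unif {wd 0 i j k, wd i j k 0, wd j k 0 i, wd k 0 i j}
    = sup4 (ket 0 i j k) (ket i j k 0) (ket j k 0 i) (ket k 0 i j)"
  using assms by (intro ext) (auto simp: unif_def sup4_def ket_def)

lemma B_all_eq: "B_all d = unif ` cells d"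
proof
  show "B_all d \<subseteq> unif ` cells d"
  proof
    fix v assume "v \<in> B_all d"
    then consider "v \<in> B1" | "v \<in> B2 d" | "v \<in> B3 d" | "v \<in> B4 d" | "v \<in> B5 d" | "v \<in> B6 d"
      | "v \<in> B7 d" | "v \<in> B8 d" | "v \<in> B9 d"
      unfolding B_all_def by blast
    then show "v \<in> unif ` cells d"
    proof cases
      case 1 then show ?thesis
        unfolding B1_def unif_1[symmetric] using b1a b1b b1c b1d by blast
    next
      case 2 then show ?thesis
        unfolding B2_def by (auto intro!: image_eqI[OF _ b2] simp: unif_2)
    next
      case 3 then show ?thesis
        unfolding B3_def by (auto intro!: image_eqI[OF _ b3] simp: unif_2)
    next
      case 4 then show ?thesis
        unfolding B4_def by (auto intro!: image_eqI[OF _ b4] simp: unif_2)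
    next
      case 5 then show ?thesis
        unfolding B5_def by (auto intro!: image_eqI[OF _ b5] simp: unif_2)
    next
      case 6 then show ?thesis
        unfolding B6_def by (auto intro!: image_eqI[OF _ b6] simp: unif_2)
    next
      case 7 then show ?thesis
        unfolding B7_def by (auto intro!: image_eqI[OF _ b7] simp: unif_2)
    next
      case 8 then show ?thesis
        unfolding B8_def by (auto intro!: image_eqI[OF _ b8] simp: unif_2)
    next
      case 9
      then obtain i j k where v: "v = sup4 (ket 0 i j k) (ket i j k 0) (ket j k 0 i) (ket k 0 i j)"
        and ijk: "i \<in> {1..d-1}" "j \<in> {1..d-1}" "k \<in> {1..d-1}"
          "(i, j, k) \<notin> {(m, m, m) | m. m \<in> {1..d-2}}"
        unfolding B9_def by blast
      then have "v = unif {wd 0 i j k, wd i j k 0, wd j k 0 i, wd k 0 i j}"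
        by (simp add: unif_4)
      moreover have "\<not> (i = j \<and> j = k \<and> i + 1 < d)"
        using ijk by auto
      ultimately show ?thesis using b9[OF ijk(1-3)] by blast
    qed
  qed
  show "unif ` cells d \<subseteq> B_all d"
  proof
    fix v assume "v \<in> unif ` cells d"
    then obtain S where S: "S \<in> cells d" and v: "v = unif S" by blast
    from S show "v \<in> B_all d"
    proof cases
      case b1a then show ?thesis by (simp add: v unif_1 B_all_def B1_def)
    next
      case b1b then show ?thesis by (simp add: v unif_1 B_all_def B1_def)
    next
      case b1c then show ?thesis by (simp add: v unif_1 B_all_def B1_def)
    next
      case b1d then show ?thesis by (simp add: v unif_1 B_all_def B1_def)
    next
      case (b2 i j)
      then have "v \<in> B2 d" unfolding B2_def by (auto simp: v unif_2)
      then show ?thesis by (simp add: B_all_def)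
    next
      case (b3 i j)
      then have "v \<in> B3 d" unfolding B3_def by (auto simp: v unif_2)
      then show ?thesis by (simp add: B_all_def)
    next
      case (b4 i j)
      then have "v \<in> B4 d" unfolding B4_def by (auto simp: v unif_2)
      then show ?thesis by (simp add: B_all_def)
    next
      case (b5 i)
      then have "v \<in> B5 d" unfolding B5_def by (auto simp: v unif_2)
      then show ?thesis by (simp add: B_all_def)
    next
      case (b6 i)
      then have "v \<in> B6 d" unfolding B6_def by (auto simp: v unif_2)
      then show ?thesis by (simp add: B_all_def)
    next
      case (b7 i)
      then have "v \<in> B7 d" unfolding B7_def by (auto simp: v unif_2)
      then show ?thesis by (simp add: B_all_def)
    next
      case (b8 i)
      then have "v \<in> B8 d" unfolding B8_def by (auto simp: v unif_2)
      then show ?thesis by (simp add: B_all_def)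
    next
      case (b9 i j k)
      then have "v = sup4 (ket 0 i j k) (ket i j k 0) (ket j k 0 i) (ket k 0 i j)"
        by (simp add: v unif_4)
      moreover have "(i, j, k) \<notin> {(m, m, m) | m. m \<in> {1..d-2}}"
        using b9(5) by auto
      ultimately have "v \<in> B9 d" unfolding B9_def using b9(2-4) by blast
      then show ?thesis by (simp add: B_all_def)
    qed
  qed
qed

lemma cells_subset_labels: "d \<ge> 2 \<Longrightarrow> S \<in> cells d \<Longrightarrow> S \<subseteq> labels d UNIV"
  by (erule cells.cases) auto

lemma finite_cell: "S \<in> cells d \<Longrightarrow> finite S"
  by (erule cells.cases) auto

lemma cell_nonempty: "S \<in> cells d \<Longrightarrow> S \<noteq> {}"
  by (erule cells.cases) auto

lemma zero_notin_cell: "S \<in> cells d \<Longrightarrow> (\<lambda>_. 0) \<notin> S"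
  by (erule cells.cases) (auto dest: fun_cong[of _ _ PartyA] fun_cong[of _ _ PartyB]
      fun_cong[of _ _ PartyC] fun_cong[of _ _ PartyD])

section \<open>Disjointness of the cells\<close>

text \<open>Every cell other than the one of \<open>1000\<close>, to which we assign \<open>000\<close>, contains exactly one
  label \<open>0bce\<close>. The cell is recovered from \<open>bce\<close>, and \<open>bce\<close> from any label in the cell; hence
  the cells are disjoint.\<close>

definition cell :: "nat \<Rightarrow> nat \<times> nat \<times> nat \<Rightarrow> party label set" where
  "cell d = (\<lambda>(b, c, e).
     if b = 0 \<and> c = 0 \<and> e = 0 then {wd 1 0 0 0}
     else insert (wd 0 b c e)
      (if b = 0 \<and> c = 0 then (if e = 1 then {} else {wd (e-1) (e-1) (e-1) 0})
       else if b = 0 \<and> e = 0 then (if c = 1 then {} else {wd (c-1) (c-1) 0 (c-1)})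
       else if c = 0 \<and> e = 0 then (if b = 1 then {} else {wd (b-1) 0 (b-1) (b-1)})
       else if e = 0 then {wd c 0 0 b}
       else if c = 0 then {wd b 0 e 0}
       else if b = 0 then {wd c e 0 0}
       else if b = c \<and> c = e \<and> b + 1 < d then {wd (b+1) 0 0 0}
       else {wd b c e 0, wd c e 0 b, wd e 0 b c}))"

text \<open>The zero pattern nearly determines the family. A label whose only zero is not at the
  first party belongs to \<open>B9\<close>, unless its nonzero entries share a value
  \<open>m\<close> with \<open>m + 1 < d\<close>; then it belongs to \<open>B5\<close>,
  \<open>B6\<close> or \<open>B7\<close>. The key \<open>(a-1, a-1, a-1)\<close> serves
  \<open>B8\<close> and, for \<open>a = 1\<close>, also the cell of \<open>1000\<close>.\<close>

definition cell_key :: "nat \<Rightarrow> party label \<Rightarrow> nat \<times> nat \<times> nat" where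
  "cell_key d w = (case (w PartyA, w PartyB, w PartyC, w PartyD) of (a, b, c, e) \<Rightarrow>
     if a = 0 then (b, c, e)
     else if b = 0 \<and> c = 0 \<and> e = 0 then (a-1, a-1, a-1)
     else if b = 0 \<and> c = 0 then (e, a, 0)
     else if b = 0 \<and> e = 0 then (a, 0, c)
     else if c = 0 \<and> e = 0 then (0, a, b)
     else if e = 0 then (if a = b \<and> b = c \<and> a + 1 < d then (0, 0, a + 1) else (a, b, c))
     else if c = 0 then (if a = b \<and> b = e \<and> a + 1 < d then (0, a + 1, 0) else (e, a, b))
     else (if a = c \<and> c = e \<and> a + 1 < d then (a + 1, 0, 0) else (c, e, a)))"

lemma cell_cell_key:
  assumes "S \<in> cells d" "w \<in> S"
  shows "S = cell d (cell_key d w)"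
proof -
  have two: ?thesis if "S = {u, v}" "cell_key d u = K" "cell_key d v = K" "cell d K = {u, v}" for u v K
  proof -
    have "cell_key d w = K" using that(1-3) assms(2) by (metis insertE singletonD)
    then show ?thesis using that(1,4) by simp
  qed
  show ?thesis
    using assms(1)
  proof cases
    case (b9 i j k)
    note proper = b9(5)
    have pos: "i > 0" "j > 0" "k > 0" using b9(2-4) by auto
    have "w = wd 0 i j k \<or> w = wd i j k 0 \<or> w = wd j k 0 i \<or> w = wd k 0 i j"
      using assms(2) b9(1) by simp
    then have "cell_key d w = (i, j, k)"
      using pos proper by (elim disjE) (simp_all add: cell_key_def, auto)
    moreover have "cell d (i, j, k) = S"
      unfolding b9(1) cell_def prod.case if_not_P[OF proper] using pos by simp
    ultimately show ?thesis by simp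
  next
    case (b2 i j)
    then show ?thesis by (intro two[OF b2(1), of "(j, i, 0)"]) (auto simp: cell_key_def cell_def)
  next
    case (b3 i j)
    then show ?thesis by (intro two[OF b3(1), of "(i, 0, j)"]) (auto simp: cell_key_def cell_def)
  next
    case (b4 i j)
    then show ?thesis by (intro two[OF b4(1), of "(0, i, j)"]) (auto simp: cell_key_def cell_def)
  next
    case (b5 i)
    then show ?thesis by (intro two[OF b5(1), of "(0, 0, i)"]) (auto simp: cell_key_def cell_def)
  next
    case (b6 i)
    then show ?thesis by (intro two[OF b6(1), of "(0, i, 0)"]) (auto simp: cell_key_def cell_def)
  next
    case (b7 i)
    then show ?thesis by (intro two[OF b7(1), of "(i, 0, 0)"]) (auto simp: cell_key_def cell_def)
  next
    case (b8 i)
    then show ?thesis by (intro two[OF b8(1), of "(i-1, i-1, i-1)"]) (auto simp: cell_key_def cell_def)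
  qed (use assms(2) in \<open>simp_all add: cell_def cell_key_def\<close>)
qed

lemma cells_disjoint: "S \<in> cells d \<Longrightarrow> S' \<in> cells d \<Longrightarrow> w \<in> S \<Longrightarrow> w \<in> S' \<Longrightarrow> S = S'"
  using cell_cell_key by metis

section \<open>Symmetry under the Klein four-group\<close>

text \<open>The cells are permuted by the regular action of the Klein four-group on the parties
  (but not by the cyclic shift, which breaks \<open>B3\<close>). So any party can be moved to the front.\<close>

fun klein :: "party \<Rightarrow> party \<Rightarrow> party" where
  "klein PartyA = case_party PartyA PartyB PartyC PartyD"
| "klein PartyB = case_party PartyB PartyA PartyD PartyC"
| "klein PartyC = case_party PartyC PartyD PartyA PartyB"
| "klein PartyD = case_party PartyD PartyC PartyB PartyA"

declare klein.simps [simp del]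

lemma klein_PartyA [simp]: "klein p PartyA = p"
  by (cases p) (auto simp: klein.simps)

lemma klein_PartyA_left [simp]: "klein PartyA q = q"
  by (cases q) (auto simp: klein.simps)

lemma klein_klein [simp]: "klein p (klein p q) = q"
  by (cases p; cases q) (auto simp: klein.simps)

lemma wd_klein:
  "wd a b c e \<circ> klein PartyB = wd b a e c"
  "wd a b c e \<circ> klein PartyC = wd c e a b"
  "wd a b c e \<circ> klein PartyD = wd e c b a"
  by (rule ext; simp add: klein.simps split: party.split)+

text \<open>The families \<open>B2\<close>, \<open>B3\<close>, \<open>B4\<close>, \<open>B9\<close>
  are each preserved. Among \<open>B5\<close> to \<open>B8\<close>, \<open>PartyB\<close> swaps 5
  with 6 and 7 with 8, \<open>PartyC\<close> swaps 5 with 7 and 6 with 8, \<open>PartyD\<close>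
  swaps 5 with 8 and 6 with 7. In \<open>B9\<close>, \<open>PartyC\<close> fixes each cell, the
  other two reverse the triple.\<close>

lemma klein_image_cell:
  assumes "S \<in> cells d"
  shows "(\<lambda>w. w \<circ> klein p) ` S \<in> cells d"
proof (cases p)
  case PartyA
  then show ?thesis using assms by (simp add: comp_def)
next
  case PartyB
  show ?thesis using assms
  proof cases
    case (b2 i j) then show ?thesis using cells.b2[of j d i] by (simp add: PartyB wd_klein insert_commute)
  next
    case (b3 i j) then show ?thesis using cells.b3[of i d j] by (simp add: PartyB wd_klein insert_commute)
  next
    case (b4 i j) then show ?thesis using cells.b4[of j d i] by (simp add: PartyB wd_klein insert_commute)
  next
    case (b5 i) then show ?thesis using cells.b6[of i d] by (simp add: PartyB wd_klein insert_commute)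
  next
    case (b6 i) then show ?thesis using cells.b5[of i d] by (simp add: PartyB wd_klein insert_commute)
  next
    case (b7 i) then show ?thesis using cells.b8[of i d] by (simp add: PartyB wd_klein insert_commute)
  next
    case (b8 i) then show ?thesis using cells.b7[of i d] by (simp add: PartyB wd_klein insert_commute)
  next
    case (b9 i j k)
    then have "{wd 0 k j i, wd k j i 0, wd j i 0 k, wd i 0 k j} \<in> cells d"
      by (intro cells.b9) auto
    then show ?thesis unfolding b9(1) by (simp add: PartyB wd_klein insert_commute)
  qed (use cells.b1a[of d] cells.b1b[of d] cells.b1c[of d] cells.b1d[of d] in \<open>simp_all add: PartyB wd_klein\<close>)
next
  case PartyC
  show ?thesis using assms
  proof cases
    case (b2 i j) then show ?thesis using cells.b2[of i d j] by (simp add: PartyC wd_klein insert_commute)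
  next
    case (b3 i j) then show ?thesis using cells.b3[of j d i] by (simp add: PartyC wd_klein insert_commute)
  next
    case (b4 i j) then show ?thesis using cells.b4[of i d j] by (simp add: PartyC wd_klein insert_commute)
  next
    case (b5 i) then show ?thesis using cells.b7[of i d] by (simp add: PartyC wd_klein insert_commute)
  next
    case (b6 i) then show ?thesis using cells.b8[of i d] by (simp add: PartyC wd_klein insert_commute)
  next
    case (b7 i) then show ?thesis using cells.b5[of i d] by (simp add: PartyC wd_klein insert_commute)
  next
    case (b8 i) then show ?thesis using cells.b6[of i d] by (simp add: PartyC wd_klein insert_commute)
  next
    case (b9 i j k)
    then show ?thesis using cells.b9[OF b9(2-5)] unfolding b9(1) by (simp add: PartyC wd_klein insert_commute)
  qed (use cells.b1a[of d] cells.b1b[of d] cells.b1c[of d] cells.b1d[of d] in \<open>simp_all add: PartyC wd_klein\<close>)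
next
  case PartyD
  show ?thesis using assms
  proof cases
    case (b2 i j) then show ?thesis using cells.b2[of j d i] by (simp add: PartyD wd_klein insert_commute)
  next
    case (b3 i j) then show ?thesis using cells.b3[of j d i] by (simp add: PartyD wd_klein insert_commute)
  next
    case (b4 i j) then show ?thesis using cells.b4[of j d i] by (simp add: PartyD wd_klein insert_commute)
  next
    case (b5 i) then show ?thesis using cells.b8[of i d] by (simp add: PartyD wd_klein insert_commute)
  next
    case (b6 i) then show ?thesis using cells.b7[of i d] by (simp add: PartyD wd_klein insert_commute)
  next
    case (b7 i) then show ?thesis using cells.b6[of i d] by (simp add: PartyD wd_klein insert_commute)
  next
    case (b8 i) then show ?thesis using cells.b5[of i d] by (simp add: PartyD wd_klein insert_commute)
  next
    case (b9 i j k)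
    then have "{wd 0 k j i, wd k j i 0, wd j i 0 k, wd i 0 k j} \<in> cells d"
      by (intro cells.b9) auto
    then show ?thesis unfolding b9(1) by (simp add: PartyD wd_klein insert_commute)
  qed (use cells.b1a[of d] cells.b1b[of d] cells.b1c[of d] cells.b1d[of d] in \<open>simp_all add: PartyD wd_klein\<close>)
qed

section \<open>Ranks and leading labels of cells\<close>

text \<open>Chosen so that, within a cell, the rank drops from the label \<open>0bce\<close> to all others.\<close>

definition rank :: "nat \<Rightarrow> nat \<times> nat \<times> nat \<Rightarrow> nat" where
  "rank d = (\<lambda>(b, c, e).
     if b > 0 \<and> c > 0 \<and> e > 0 then 2 * d + 2
     else if b > 0 \<and> c > 0 then 2 * b + 1
     else if e > 0 \<and> (b > 0 \<or> c > 0) then 2 * e + 1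
     else 2 * (b + c + e))"

definition party_rank :: "nat \<Rightarrow> party \<Rightarrow> party label \<Rightarrow> nat" where
  "party_rank d p w = rank d (w (klein p PartyB), w (klein p PartyC), w (klein p PartyD))"

text \<open>\<open>klein p\<close> sends only \<open>PartyA\<close> to \<open>p\<close>, so the rank
  never reads the value at \<open>p\<close>; resetting that value to \<open>0\<close> is harmless in
  an induction on rank.\<close>

lemma party_rank_upd [simp]: "party_rank d p (w(p := a)) = party_rank d p w"
  by (cases p) (simp_all add: party_rank_def klein.simps)

lemma cell_in_cells:
  assumes "b < d" "c < d" "e < d"
  shows "cell d (b, c, e) \<in> cells d"
proof -
  consider "b = 0" "c = 0" "e = 0" | "b = 0" "c = 0" "e > 0" | "b = 0" "c > 0" "e = 0"
    | "b > 0" "c = 0" "e = 0" | "b > 0" "c > 0" "e = 0" | "b > 0" "c = 0" "e > 0"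
    | "b = 0" "c > 0" "e > 0" | "b > 0" "c > 0" "e > 0"
    by blast
  then show ?thesis
  proof cases
    case 1 then show ?thesis using b1a[of d] by (simp add: cell_def)
  next
    case 2 then show ?thesis using b1d[of d] b5[of e d] assms by (cases "e = 1") (simp_all add: cell_def)
  next
    case 3 then show ?thesis using b1c[of d] b6[of c d] assms by (cases "c = 1") (simp_all add: cell_def)
  next
    case 4 then show ?thesis using b1b[of d] b7[of b d] assms by (cases "b = 1") (simp_all add: cell_def)
  next
    case 5 then show ?thesis using b2[of c d b] assms by (simp add: cell_def)
  next
    case 6 then show ?thesis using b3[of b d e] assms by (simp add: cell_def)
  next
    case 7 then show ?thesis using b4[of c d e] assms by (simp add: cell_def)
  next
    case 8
    show ?thesis
    proof (cases "b = c \<and> c = e \<and> b + 1 < d")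
      case True
      then have bd: "b + 1 \<in> {2..d-1}" using 8 by auto
      from True show ?thesis using b8[of "b + 1" d] 8 bd by (simp add: cell_def)
    next
      case False
      then have "{wd 0 b c e, wd b c e 0, wd c e 0 b, wd e 0 b c} \<in> cells d"
        using False 8 assms by (intro b9) auto
      moreover have "cell d (b, c, e) = {wd 0 b c e, wd b c e 0, wd c e 0 b, wd e 0 b c}"
        unfolding cell_def prod.case if_not_P[OF False] using 8 by simp
      ultimately show ?thesis by simp
    qed
  qed
qed

text \<open>One nonzero entry \<open>m\<close> has rank \<open>2 * m\<close>, two have an odd rank
  \<open>2 * m + 1\<close>. In \<open>B2\<close> to \<open>B4\<close> the entry \<open>m\<close>
  survives in the partner label, so the rank falls from \<open>2 * m + 1\<close> to
  \<open>2 * m\<close>; in \<open>B5\<close> to \<open>B7\<close> it falls from \<open>2 * i\<close>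
  to \<open>2 * (i - 1) + 1\<close>. Three nonzero entries outrank all else, which settles
  \<open>B8\<close> and \<open>B9\<close>.\<close>

lemma party_rank_PartyA_less:
  assumes "S \<in> cells d" "w \<in> S" "w PartyA = 0" "w' \<in> S" "w' \<noteq> w"
  shows "w' PartyA \<noteq> 0 \<and> party_rank d PartyA w' < party_rank d PartyA w"
proof -
  have two: ?thesis if "S = {u, v}" "u PartyA = 0" "v PartyA \<noteq> 0"
    "party_rank d PartyA v < party_rank d PartyA u" for u v
  proof -
    have "w = u" using that(1-3) assms(2,3) by (metis insertE singletonD)
    moreover have "w' = v" using that(1) assms(4,5) \<open>w = u\<close> by (metis insertE singletonD)
    ultimately show ?thesis using that(3,4) by simp
  qed
  show ?thesis
    using assms(1)
  proof cases
    case (b9 i j k)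
    have lt: "i < d" "j < d" "k < d" using b9(2-4) by auto
    have "w = wd 0 i j k" using assms(2,3) b9(1-4) by auto
    moreover from this have "w' = wd i j k 0 \<or> w' = wd j k 0 i \<or> w' = wd k 0 i j"
      using assms(4,5) b9(1) by simp
    ultimately show ?thesis using b9(2-4) lt by (elim disjE) (simp_all add: party_rank_def rank_def)
  next
    case (b2 i j)
    then show ?thesis by (intro two[OF b2(1)]) (simp_all add: party_rank_def rank_def, arith?)
  next
    case (b3 i j)
    then show ?thesis by (intro two[OF b3(1)]) (simp_all add: party_rank_def rank_def, arith?)
  next
    case (b4 i j)
    then show ?thesis by (intro two[OF b4(1)]) (simp_all add: party_rank_def rank_def, arith?)
  next
    case (b5 i)
    then show ?thesis by (intro two[OF b5(1)]) (simp_all add: party_rank_def rank_def, arith?)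
  next
    case (b6 i)
    then show ?thesis by (intro two[OF b6(1)]) (simp_all add: party_rank_def rank_def, arith?)
  next
    case (b7 i)
    then show ?thesis by (intro two[OF b7(1)]) (simp_all add: party_rank_def rank_def, arith?)
  next
    case (b8 i)
    then show ?thesis by (intro two[OF b8(1)]) (simp_all add: party_rank_def rank_def, arith?)
  qed (use assms(2-5) in simp_all)
qed

lemma cell_covering_PartyA:
  assumes "w \<in> labels d UNIV" "w PartyA = 0" "w \<noteq> (\<lambda>_. 0)"
  shows "\<exists>S\<in>cells d. w \<in> S \<and>
    (\<forall>w'\<in>S - {w}. w' PartyA \<noteq> 0 \<and> party_rank d PartyA w' < party_rank d PartyA w)"
proof -
  define b c e where bce: "b = w PartyB" "c = w PartyC" "e = w PartyD"
  have w: "w = wd 0 b c e" using wd_expand[of w] assms(2) by (simp add: bce)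
  have lt: "b < d" "c < d" "e < d" using assms(1) by (auto simp: bce labels_UNIV_iff)
  have nz: "\<not> (b = 0 \<and> c = 0 \<and> e = 0)"
    using assms(3) by (auto simp: w split: party.split)
  have w_in: "w \<in> cell d (b, c, e)" using nz by (simp add: w cell_def)
  have "\<forall>w'\<in>cell d (b, c, e) - {w}. w' PartyA \<noteq> 0 \<and> party_rank d PartyA w' < party_rank d PartyA w"
    using party_rank_PartyA_less[where w = w, OF cell_in_cells[OF lt] w_in assms(2)] w_in by blast
  then show ?thesis using cell_in_cells[OF lt] w_in by blast
qed

text \<open>\<open>klein p\<close> moves \<open>p\<close> to the front, where \<open>cell\<close>
  gives the set explicitly. Since \<open>w\<close> alone is \<open>0\<close> at \<open>p\<close> in
  its cell, single entries of an operator can be read off from sums over cells.\<close>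

lemma cell_covering:
  assumes "w \<in> labels d UNIV" "w p = 0" "w \<noteq> (\<lambda>_. 0)"
  shows "\<exists>S\<in>cells d. w \<in> S \<and> (\<forall>w'\<in>S - {w}. w' p \<noteq> 0 \<and> party_rank d p w' < party_rank d p w)"
proof -
  let ?k = "\<lambda>w. w \<circ> klein p"
  have kk: "?k (?k w) = w" for w :: "party label" by (rule ext) simp
  have rk: "party_rank d PartyA (?k w) = party_rank d p w" for w
    by (simp add: party_rank_def)
  have "?k w \<noteq> (\<lambda>_. 0)"
  proof
    assume "?k w = (\<lambda>_. 0)"
    from arg_cong[OF this, of ?k] have "w = (\<lambda>_. 0)"
      unfolding kk by (simp add: comp_def)
    with assms(3) show False ..
  qed
  then obtain S where S: "S \<in> cells d" "?k w \<in> S"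
    "\<forall>w'\<in>S - {?k w}. w' PartyA \<noteq> 0 \<and> party_rank d PartyA w' < party_rank d PartyA (?k w)"
    using cell_covering_PartyA[of "?k w" d] assms by (auto simp: labels_UNIV_iff)
  have "w \<in> ?k ` S" using S(2) kk by (metis image_eqI)
  moreover have "w' p \<noteq> 0 \<and> party_rank d p w' < party_rank d p w" if "w' \<in> ?k ` S - {w}" for w'
  proof -
    have "?k w' \<in> S - {?k w}" using that kk by auto
    with S(3) have "?k w' PartyA \<noteq> 0 \<and> party_rank d PartyA (?k w') < party_rank d PartyA (?k w)"
      by blast
    then show ?thesis by (simp add: rk)
  qed
  ultimately have "w \<in> ?k ` S \<and> (\<forall>w'\<in>?k ` S - {w}. w' p \<noteq> 0 \<and> party_rank d p w' < party_rank d p w)"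
    by blast
  then show ?thesis by (rule bexI[OF _ klein_image_cell[OF S(1)]])
qed

text \<open>Singleton cells isolate single entries: this one provides the known row of the circulant
  matrix and the value of the scalar.\<close>

lemma unit_cell: "{\<lambda>q. of_bool (q = p)} \<in> cells d"
proof -
  have "(\<lambda>q. of_bool (q = p)) = wd (of_bool (p = PartyA)) (of_bool (p = PartyB))
      (of_bool (p = PartyC)) (of_bool (p = PartyD))"
    by (rule ext) (auto split: party.split)
  then show ?thesis using b1a b1b b1c b1d by (cases p) auto
qed

section \<open>Operators supported away from one party\<close>

lemma sum_sum_diagonal:
  "finite S \<Longrightarrow> (\<Sum>x\<in>S. \<Sum>y\<in>S. c * of_bool (x = y)) = (c :: complex) * of_nat (card S)"
  by (simp add: of_bool_def if_distrib cong: if_cong)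

text \<open>\<open>block\<close> and \<open>translate\<close> express that \<open>T\<close> acts as
  the identity on party \<open>p\<close>; \<open>zero_row\<close> is orthogonality to
  \<open>psi 0\<close>, already resolved into single cells.\<close>

context
  fixes d :: nat and p :: party and T :: "party operator"
  assumes d: "d \<ge> 2"
    and block: "\<And>x y. x p \<noteq> y p \<Longrightarrow> T x y = 0"
    and translate: "\<And>x y. x p = y p \<Longrightarrow> T x y = T (x(p := 0)) (y(p := 0))"
    and zero_row: "\<And>S. S \<in> cells d \<Longrightarrow> (\<Sum>y\<in>S. T (\<lambda>_. 0) y) = 0"
begin

lemma zero_row_entry:
  assumes "w \<in> labels d UNIV" "w \<noteq> (\<lambda>_. 0)"
  shows "T (\<lambda>_. 0) w = 0"
proof (cases "w p = 0")
  case True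
  then obtain S where S: "S \<in> cells d" "w \<in> S" "\<forall>w'\<in>S - {w}. w' p \<noteq> 0"
    using cell_covering[OF assms(1) True assms(2)] by blast
  have "(\<Sum>y\<in>S. T (\<lambda>_. 0) y) = T (\<lambda>_. 0) w"
    using S block[of "\<lambda>_. 0"] finite_cell[OF S(1)] by (subst sum.remove[of _ w]) auto
  then show ?thesis using zero_row S(1) by simp
qed (use block[of "\<lambda>_. 0" w] in auto)

text \<open>Each term vanishes by itself. If \<open>y p = 1\<close>, resetting the value at
  \<open>p\<close> turns the unit label into the zero label and \<open>y\<close> into a nonzero
  label, so \<open>zero_row_entry\<close> applies; otherwise \<open>block\<close> does.\<close>

lemma unit_row:
  assumes "S \<in> cells d" "S \<noteq> {\<lambda>q. of_bool (q = p)}"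
  shows "(\<Sum>y\<in>S. T (\<lambda>q. of_bool (q = p)) y) = 0"
proof (rule sum.neutral, rule ballI)
  fix y assume y: "y \<in> S"
  let ?u = "\<lambda>q. of_bool (q = p) :: nat"
  have yu: "y \<noteq> ?u"
    using cells_disjoint[OF assms(1) unit_cell y] assms(2) by auto
  show "T ?u y = 0"
  proof (cases "y p = 1")
    case True
    have "?u(p := 0) = (\<lambda>_. 0)" by (rule ext) simp
    then have "T ?u y = T (\<lambda>_. 0) (y(p := 0))"
      using translate[of ?u y] True by simp
    moreover have "y(p := 0) \<in> labels d UNIV"
      using cells_subset_labels[OF d assms(1)] y d by (auto simp: labels_UNIV_iff)
    moreover have "y(p := 0) \<noteq> (\<lambda>_. 0)"
    proof
      assume "y(p := 0) = (\<lambda>_. 0)"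
      then have "y q = ?u q" for q using True by (cases "q = p") (auto dest: fun_cong[of _ _ q])
      with yu show False by auto
    qed
    ultimately show ?thesis using zero_row_entry by simp
  qed (use block[of ?u y] in auto)
qed

lemma scalar_operator:
  assumes zero_column: "\<And>S. S \<in> cells d \<Longrightarrow> (\<Sum>x\<in>S. T x (\<lambda>_. 0)) = 0"
    and off: "\<And>S S'. S \<in> cells d \<Longrightarrow> S' \<in> cells d \<Longrightarrow> S \<noteq> S' \<Longrightarrow> (\<Sum>x\<in>S. \<Sum>y\<in>S'. T x y) = 0"
    and diag: "\<And>S. S \<in> cells d \<Longrightarrow> (\<Sum>x\<in>S. \<Sum>y\<in>S. T x y) = c * of_nat (card S)"
    and "x \<in> labels d UNIV" "y \<in> labels d UNIV"
  shows "T x y = c * of_bool (x = y)"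
proof -
  let ?z = "\<lambda>_. 0 :: nat"
  have zz: "T ?z ?z = c"
  proof -
    have "(\<lambda>q. of_bool (q = p))(p := 0) = ?z" by (rule ext) simp
    then show ?thesis
      using diag[OF unit_cell[of p]] translate[of "\<lambda>q. of_bool (q = p)" "\<lambda>q. of_bool (q = p)"] by simp
  qed
  have "T x y = c * of_bool (x = y)"
    if "x \<in> labels d UNIV" "y \<in> labels d UNIV" "x p = 0" "y p = 0" for x y
    using that
  \<comment> \<open>The rank of the row label alone drives the induction; the column label stays
    arbitrary.\<close>
  proof (induction "party_rank d p x" arbitrary: x y rule: less_induct)
    case less
    show ?case
    proof (cases "x = ?z \<or> y = ?z")
      case True
      have "T x ?z = 0" if nz: "x \<noteq> ?z"
      proof -
        obtain S where S: "S \<in> cells d" "x \<in> S" "\<forall>w'\<in>S - {x}. w' p \<noteq> 0"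
          using cell_covering[OF less.prems(1,3) nz] by blast
        have "(\<Sum>w\<in>S. T w ?z) = T x ?z"
          using S block[of _ ?z] finite_cell[OF S(1)] by (subst sum.remove[of _ x]) auto
        then show ?thesis using zero_column S(1) by simp
      qed
      then show ?thesis using True zz zero_row_entry less.prems by fastforce
    next
      case False
      then obtain S where S: "S \<in> cells d" "x \<in> S"
        "\<And>w. w \<in> S - {x} \<Longrightarrow> w p \<noteq> 0 \<and> party_rank d p w < party_rank d p x"
        using cell_covering[OF less.prems(1,3)] by metis
      obtain S' where S': "S' \<in> cells d" "y \<in> S'" "\<And>w. w \<in> S' - {y} \<Longrightarrow> w p \<noteq> 0"
        using cell_covering[OF less.prems(2,4)] False by metis
      \<comment> \<open>Both labels are nonzero at \<open>p\<close>. If their values there agree,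
        resetting them to \<open>0\<close> keeps the rank of \<open>v\<close>, so the induction
        hypothesis applies, even when a reset label is the zero label.\<close>
      have rest: "T v w = c * of_bool (v = w)" if v: "v \<in> S - {x}" and w: "w \<in> S' - {y}" for v w
      proof (cases "v p = w p")
        case True
        have "T (v(p := 0)) (w(p := 0)) = c * of_bool (v(p := 0) = w(p := 0))"
        proof (rule less.hyps)
          show "party_rank d p (v(p := 0)) < party_rank d p x"
            using S(3)[OF v] by simp
          show "v(p := 0) \<in> labels d UNIV" "w(p := 0) \<in> labels d UNIV"
            using v w cells_subset_labels[OF d S(1)] cells_subset_labels[OF d S'(1)]
            using d by (auto simp: labels_UNIV_iff)
        qed auto
        moreover have "v(p := 0) = w(p := 0) \<longleftrightarrow> v = w"
          using True by (metis fun_upd_triv fun_upd_upd)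
        ultimately show ?thesis using translate[of v w] True by simp
      qed (use block in auto)
      \<comment> \<open>Terms containing exactly one of \<open>x\<close> and \<open>y\<close> pair a
        zero with a nonzero value at \<open>p\<close>, so \<open>block\<close> removes them.\<close>
      have "(\<Sum>v\<in>S. \<Sum>w\<in>S'. T v w)
          = T x y + (\<Sum>w\<in>S' - {y}. T x w) + (\<Sum>v\<in>S - {x}. T v y + (\<Sum>w\<in>S' - {y}. T v w))"
        by (simp only: sum.remove[OF finite_cell[OF S(1)] S(2)] sum.remove[OF finite_cell[OF S'(1)] S'(2)])
      also have "(\<Sum>w\<in>S' - {y}. T x w) = 0"
        using S'(3) less.prems(3) block by (intro sum.neutral) metis
      also have "(\<Sum>v\<in>S - {x}. T v y + (\<Sum>w\<in>S' - {y}. T v w))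
          = (\<Sum>v\<in>S - {x}. \<Sum>w\<in>S' - {y}. c * of_bool (v = w))"
        using S(3) less.prems(4) block rest by (intro sum.cong refl) simp
      finally have split: "(\<Sum>v\<in>S. \<Sum>w\<in>S'. T v w)
          = T x y + (\<Sum>v\<in>S - {x}. \<Sum>w\<in>S' - {y}. c * of_bool (v = w))" by simp
      show ?thesis
      proof (cases "S = S'")
        case True
        \<comment> \<open>A cell has only one label that is \<open>0\<close> at \<open>p\<close>.
          The other diagonal entries contribute \<open>card S - 1\<close> times \<open>c\<close>,
          which leaves \<open>c\<close> for \<open>T x x\<close>.\<close>
        then have "x = y" using S'(3)[of x] S(2) less.prems(3) by auto
        have "(\<Sum>v\<in>S - {x}. \<Sum>w\<in>S' - {y}. c * of_bool (v = w)) = c * of_nat (card (S - {x}))"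
          using finite_cell[OF S(1)] unfolding \<open>x = y\<close>[symmetric] True[symmetric]
          by (intro sum_sum_diagonal) simp
        moreover have "card S = Suc (card (S - {x}))"
          using finite_cell[OF S(1)] S(2) by (metis card.remove)
        ultimately show ?thesis
          using split diag[OF S(1)] \<open>x = y\<close> True by (simp add: algebra_simps)
      next
        case False
        then have "S \<inter> S' = {}" using cells_disjoint[OF S(1) S'(1)] by blast
        then have "(\<Sum>v\<in>S - {x}. \<Sum>w\<in>S' - {y}. c * of_bool (v = w)) = 0"
          by (intro sum.neutral ballI) auto
        moreover have "x \<noteq> y" using \<open>S \<inter> S' = {}\<close> S(2) S'(2) by auto
        ultimately show ?thesis using split off[OF S(1) S'(1) False] by simp
      qed
    qed
  qed
  note main = this
  show ?thesis
  proof (cases "x p = y p")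
    case True
    have "T (x(p := 0)) (y(p := 0)) = c * of_bool (x(p := 0) = y(p := 0))"
      using assms(4,5) d by (intro main) (auto simp: labels_UNIV_iff)
    moreover have "x(p := 0) = y(p := 0) \<longleftrightarrow> x = y"
      using True by (metis fun_upd_triv fun_upd_upd)
    ultimately show ?thesis using translate[of x y] True by simp
  qed (use block in auto)
qed

end

section \<open>Strongest nonlocality of the family\<close>

lemma finite_labels_UNIV [simp]: "finite (labels d (UNIV :: party set))"
  unfolding labels_def by (intro finite_PiE) auto

lemma braket_sum_left:
  "braket d X (\<lambda>x. \<Sum>j\<in>J. c j * u j x) v = (\<Sum>j\<in>J. cnj (c j) * braket d X (u j) v)"
  unfolding braket_def
  by (simp add: cnj_sum sum_distrib_left sum_distrib_right mult.assoc sum.swap[of _ _ J])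

lemma braket_apply_sum_right:
  "braket d X u (apply_op d X T (\<lambda>x. \<Sum>k\<in>K. c k * v k x))
    = (\<Sum>k\<in>K. c k * braket d X u (apply_op d X T (v k)))"
proof -
  have "apply_op d X T (\<lambda>x. \<Sum>k\<in>K. c k * v k x) x = (\<Sum>k\<in>K. c k * apply_op d X T (v k) x)" for x
    unfolding apply_op_def
    by (simp add: sum_distrib_left mult_ac sum.swap[of _ _ K])
  then show ?thesis
    unfolding braket_def
    by (simp add: sum_distrib_left mult_ac sum.swap[of _ _ K])
qed

lemma braket_unif:
  assumes "S \<subseteq> labels d UNIV" "S' \<subseteq> labels d UNIV"
  shows "braket d UNIV (unif S) (apply_op d UNIV T (unif S'))
    = (\<Sum>x\<in>S. \<Sum>y\<in>S'. T x y) / (complex_of_real (sqrt (card S)) * complex_of_real (sqrt (card S')))"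
proof -
  let ?L = "labels d (UNIV :: party set)"
  have fin: "finite S" "finite S'" using assms finite_subset[OF _ finite_labels_UNIV] by auto
  have apply_unif: "apply_op d UNIV T (unif S') x = (\<Sum>y\<in>S'. T x y) / complex_of_real (sqrt (card S'))"
    if "x \<in> ?L" for x
  proof -
    have "apply_op d UNIV T (unif S') x = (\<Sum>y\<in>?L. if y \<in> S' then T x y / complex_of_real (sqrt (card S')) else 0)"
      using that by (simp add: apply_op_def unif_def) (intro sum.cong, auto)
    also have "\<dots> = (\<Sum>y\<in>S'. T x y / complex_of_real (sqrt (card S')))"
      using assms(2) by (simp add: sum.If_cases Int_absorb1)
    finally show ?thesis by (simp add: sum_divide_distrib)
  qed
  have "braket d UNIV (unif S) (apply_op d UNIV T (unif S'))
      = (\<Sum>x\<in>?L. if x \<in> S then (\<Sum>y\<in>S'. T x y) / complex_of_real (sqrt (card S')) / complex_of_real (sqrt (card S)) else 0)"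
    unfolding braket_def by (intro sum.cong refl) (simp add: apply_unif, simp add: unif_def)
  also have "\<dots> = (\<Sum>x\<in>S. (\<Sum>y\<in>S'. T x y) / complex_of_real (sqrt (card S')) / complex_of_real (sqrt (card S)))"
    using assms(1) by (simp add: sum.If_cases Int_absorb1)
  finally show ?thesis by (simp add: sum_divide_distrib mult.commute)
qed

text \<open>Supplies \<open>block\<close>: labels differing at a party outside \<open>X\<close>
  differ on the complement of \<open>X\<close>, where the operator is the identity.\<close>

lemma extend_op_block:
  assumes "p \<notin> X" "x p \<noteq> y p"
  shows "extend_op X E x y = 0"
proof -
  have "restrict x (- X) \<noteq> restrict y (- X)"
    using assms by (metis ComplI restrict_apply')
  then show ?thesis by (simp add: extend_op_def)
qed

text \<open>Supplies \<open>translate\<close>: \<open>E\<close> does not see \<open>p\<close>, and a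
  common new value at \<open>p\<close> does not affect agreement on the complement.\<close>

lemma extend_op_translate:
  assumes "p \<notin> X" "x p = y p"
  shows "extend_op X E x y = extend_op X E (x(p := a)) (y(p := a))"
proof -
  have "restrict (z(p := a)) X = restrict z X" for z
    using assms(1) by (auto simp: restrict_def)
  moreover have "restrict (x(p := a)) (- X) = restrict (y(p := a)) (- X) \<longleftrightarrow> restrict x (- X) = restrict y (- X)"
    using assms unfolding fun_eq_iff restrict_def by auto
  ultimately show ?thesis by (simp add: extend_op_def)
qed

theorem theorem3:
  fixes d :: nat and \<alpha> :: "nat \<Rightarrow> party vect"
  assumes "d \<ge> 2"
    and "\<alpha> 0 = ket 0 0 0 0"
    and "bij_betw \<alpha> {1..d^3} (B_all d)"
    and "\<alpha> 1 = ket 1 0 0 0"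
    and "\<alpha> 2 = ket 0 0 0 1"
    and "\<alpha> 3 = ket 0 0 1 0"
    and "\<alpha> 4 = ket 0 1 0 0"
  shows "strongest_nonlocal d (psi d \<alpha> ` {0..d^3}) \<and> card (psi d \<alpha> ` {0..d^3}) = d^3 + 1"
proof -
  define n where "n = d ^ 3"
  have n: "n > 0" using assms(1) by (simp add: n_def)
  let ?L = "labels d (UNIV :: party set)"
  let ?z = "(\<lambda>_. 0) :: party label"
  let ?psi = "psi d \<alpha>"
  define sw where "sw T u v = braket d UNIV u (apply_op d UNIV T v)" for T :: "party operator" and u v

  have "\<exists>S. S \<in> cells d \<and> \<alpha> j = unif S" if "j \<in> {1..n}" for j
    using bij_betwE[OF assms(3)] that unfolding B_all_eq n_def by blast
  then obtain S where S: "\<And>j. j \<in> {1..n} \<Longrightarrow> S j \<in> cells d" "\<And>j. j \<in> {1..n} \<Longrightarrow> \<alpha> j = unif (S j)"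
    by metis
  have unif_inj: "U = V" if UV: "unif U = unif V" "U \<in> cells d" "V \<in> cells d" for U V
  proof -
    obtain x where x: "x \<in> U" using cell_nonempty[OF UV(2)] by blast
    have "unif U x \<noteq> 0" using x finite_cell[OF that(2)] by (auto simp: unif_def)
    then have "x \<in> V" unfolding that(1) by (auto simp: unif_def)
    then show ?thesis using cells_disjoint that x by blast
  qed
  have S_inj: "S j \<noteq> S k" if "j \<in> {1..n}" "k \<in> {1..n}" "j \<noteq> k" for j k
    using bij_betw_imp_inj_on[OF assms(3)] S that unfolding n_def by (metis inj_onD)
  have S_surj: "\<exists>j\<in>{1..n}. U = S j" if U: "U \<in> cells d" for U
  proof -
    have "unif U \<in> \<alpha> ` {1..n}"
      using bij_betw_imp_surj_on[OF assms(3)] U unfolding B_all_eq n_def by blast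
    then obtain j where "j \<in> {1..n}" "unif U = unif (S j)" using S by auto
    then show ?thesis using unif_inj[OF _ U S(1)] by blast
  qed
  have S_sub: "S j \<subseteq> ?L" if "j \<in> {1..n}" for j
    using cells_subset_labels[OF assms(1) S(1)[OF that]] .
  have card_S: "card (S j) > 0" if "j \<in> {1..n}" for j
    using cell_nonempty[OF S(1)[OF that]] finite_cell[OF S(1)[OF that]] by (simp add: card_gt_0_iff)

  have alpha_0: "\<alpha> 0 = unif {?z}"
  proof -
    have "?z = wd 0 0 0 0" by (rule ext) (simp split: party.split)
    then show ?thesis using assms(2) by (simp only: unif_1)
  qed
  have z_sub: "{?z} \<subseteq> ?L" using assms(1) by (simp add: labels_UNIV_iff)

  have psi_0: "?psi 0 = \<alpha> 0" by (simp add: psi_def)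
  have psi_pos: "?psi i = (\<lambda>x. \<Sum>j=1..n. omega n ^ (i * j) * \<alpha> j x)" if "i > 0" for i
    using that by (simp add: psi_def n_def)

  have sw_alpha: "sw T (\<alpha> j) (\<alpha> k) = (\<Sum>x\<in>S j. \<Sum>y\<in>S k. T x y)
      / (complex_of_real (sqrt (card (S j))) * complex_of_real (sqrt (card (S k))))"
    if "j \<in> {1..n}" "k \<in> {1..n}" for T j k
    using S(2) S_sub that by (simp add: sw_def braket_unif)
  have sw_psi_psi: "sw T (?psi i) (?psi l)
      = (\<Sum>j=1..n. \<Sum>k=1..n. cnj (omega n ^ (i * j)) * omega n ^ (l * k) * sw T (\<alpha> j) (\<alpha> k))"
    if "i > 0" "l > 0" for T i l
    unfolding sw_def psi_pos[OF that(1)] psi_pos[OF that(2)] braket_sum_left braket_apply_sum_right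
    by (simp only: sum_distrib_left mult.assoc)
  have sw_0_psi: "sw T (?psi 0) (?psi l)
      = (\<Sum>k=1..n. omega n ^ (l * k) * ((\<Sum>y\<in>S k. T ?z y) / complex_of_real (sqrt (card (S k)))))"
    if "l > 0" for T l
    unfolding sw_def psi_pos[OF that] braket_apply_sum_right psi_0
    using S(2) S_sub z_sub by (intro sum.cong refl) (simp add: alpha_0 braket_unif)
  have sw_psi_0: "sw T (?psi i) (?psi 0)
      = (\<Sum>j=1..n. cnj (omega n ^ (i * j)) * ((\<Sum>x\<in>S j. T x ?z) / complex_of_real (sqrt (card (S j)))))"
    if "i > 0" for T i
    unfolding sw_def psi_pos[OF that] braket_sum_left psi_0
    using S(2) S_sub z_sub by (intro sum.cong refl) (simp add: alpha_0 braket_unif)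

  \<comment> \<open>Plain inner products are the case of the identity operator, so the expansions of
    \<open>sw\<close> also yield the Gram matrix.\<close>
  have braket_sw: "braket d UNIV u v = sw (\<lambda>x y. of_bool (x = y)) u v" for u v :: "party vect"
  proof -
    have "apply_op d UNIV (\<lambda>x y. of_bool (x = y)) v x = v x" if "x \<in> ?L" for x
    proof -
      have "apply_op d UNIV (\<lambda>x y. of_bool (x = y)) v x = (\<Sum>y\<in>?L. if x = y then v y else 0)"
        using that by (simp add: apply_op_def)
      then show ?thesis using that by simp
    qed
    then show ?thesis unfolding sw_def braket_def by simp
  qed
  have id_alpha: "sw (\<lambda>x y. of_bool (x = y)) (\<alpha> j) (\<alpha> k) = of_bool (j = k)"
    if jk: "j \<in> {1..n}" "k \<in> {1..n}" for j k
  proof (cases "j = k")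
    case True
    have "complex_of_real (sqrt (card (S k))) * complex_of_real (sqrt (card (S k))) = of_nat (card (S k))"
      by (simp flip: of_real_mult)
    then show ?thesis
      using sum_sum_diagonal[OF finite_cell[OF S(1)[OF jk(2)]], of 1] card_S[OF jk(2)]
      unfolding True sw_alpha[OF jk(2,2)] by simp
  next
    case False
    then have "S j \<inter> S k = {}" using cells_disjoint[OF S(1)[OF jk(1)] S(1)[OF jk(2)]] S_inj[OF jk] by blast
    then have "(\<Sum>x\<in>S j. \<Sum>y\<in>S k. of_bool (x = y) :: complex) = 0"
      by (intro sum.neutral ballI) auto
    then show ?thesis unfolding sw_alpha[OF jk] using False by simp
  qed
  \<comment> \<open>The squared norms are 1 for \<open>psi 0\<close> and \<open>n\<close> for the
    others; distinctness, nonvanishing and orthogonality of the states all follow from this.\<close>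
  have gram: "braket d UNIV (?psi i) (?psi l) = of_bool (i = l) * (if i = 0 then 1 else of_nat n)"
    if il: "i \<in> {0..n}" "l \<in> {0..n}" for i l
  proof -
    have notin: "?z \<notin> S j" if "j \<in> {1..n}" for j using zero_notin_cell[OF S(1)[OF that]] .
    consider "i = 0" "l = 0" | "i = 0" "l > 0" | "i > 0" "l = 0" | "i > 0" "l > 0" by blast
    then show ?thesis
    proof cases
      case 1
      have "sw (\<lambda>x y. of_bool (x = y)) (unif {?z}) (unif {?z}) = 1"
        unfolding sw_def braket_unif[OF z_sub z_sub] by simp
      then show ?thesis by (simp add: 1 braket_sw psi_0 alpha_0)
    next
      case 2
      have "(\<Sum>y\<in>S k. of_bool (?z = y) :: complex) = 0" if "k \<in> {1..n}" for k
        using notin[OF that] by (intro sum.neutral) auto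
      then show ?thesis using 2 by (simp add: braket_sw sw_0_psi)
    next
      case 3
      have "(\<Sum>x\<in>S k. of_bool (x = ?z) :: complex) = 0" if "k \<in> {1..n}" for k
        using notin[OF that] by (intro sum.neutral) auto
      then show ?thesis using 3 by (simp add: braket_sw sw_psi_0)
    next
      case 4
      have "braket d UNIV (?psi i) (?psi l)
          = (\<Sum>j=1..n. \<Sum>k=1..n. if k = j then cnj (omega n ^ (i * j)) * omega n ^ (l * k) else 0)"
        unfolding braket_sw sw_psi_psi[OF 4] by (intro sum.cong refl) (simp only: id_alpha, simp)
      also have "\<dots> = (\<Sum>j=1..n. cnj (omega n ^ (i * j)) * omega n ^ (l * j))"
        by (intro sum.cong refl) (simp only: sum.delta finite_atLeastAtMost if_True)
      also have "\<dots> = of_nat n * of_bool (i = l)"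
        using 4 il by (intro omega_orthogonality_transposed n) auto
      finally show ?thesis using 4 by simp
    qed
  qed
  have psi_inj: "inj_on ?psi {0..n}"
  proof (rule inj_onI, rule ccontr)
    fix i l assume il: "i \<in> {0..n}" "l \<in> {0..n}" "?psi i = ?psi l" "i \<noteq> l"
    then show False using gram[OF il(1,2)] gram[OF il(2,2)] n by (auto split: if_splits)
  qed
  have "card (?psi ` {0..n}) = n + 1"
    using card_image[OF psi_inj] by simp
  moreover have "?psi i \<in> vectors d UNIV - {\<lambda>_. 0}" if "i \<in> {0..n}" for i
  proof
    have "\<alpha> j x = 0" if "j \<in> {0..n}" "x \<notin> ?L" for j x
    proof (cases "j = 0")
      case True
      then show ?thesis using alpha_0 z_sub that by (auto simp: unif_def)
    next
      case False
      then have "j \<in> {1..n}" using that by simp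
      then show ?thesis using S(2) S_sub that(2) by (auto simp: unif_def)
    qed
    then show "?psi i \<in> vectors d UNIV"
      by (cases "i = 0") (auto simp: vectors_def psi_0 psi_pos intro!: sum.neutral)
    show "?psi i \<notin> {\<lambda>_. 0}"
      using gram[OF that that] n by (auto simp: braket_def split: if_splits)
  qed
  moreover have "mutually_orthogonal d (?psi ` {0..n})"
    unfolding mutually_orthogonal_def pairwise_def using gram by (auto simp: image_iff)
  \<comment> \<open>Applied to \<open>X\<close> and to \<open>- X\<close>, this covers both sides of
    a bipartition, since each side misses some party.\<close>
  moreover have "trivial_povm d X k E"
    if X: "- X \<noteq> {}" and E: "oplm d (?psi ` {0..n}) X k E" for X k E
    unfolding trivial_povm_def
  proof (intro allI impI)
    fix m assume m: "m < k"
    define T where "T = extend_op X (E m)"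
    obtain p where p: "p \<notin> X" using X by blast
    \<comment> \<open>\<open>oplm\<close> compares distinct vectors, so \<open>psi_inj\<close> is
      what makes distinct indices sufficient.\<close>
    have orth: "sw T (?psi i) (?psi l) = 0" if "i \<in> {0..n}" "l \<in> {0..n}" "i \<noteq> l" for i l
    proof -
      have "?psi i \<noteq> ?psi l" using inj_onD[OF psi_inj] that by blast
      then show ?thesis
        using E m that unfolding oplm_def pairwise_def sw_def T_def by blast
    qed
    have row: "(\<Sum>y\<in>S j. T ?z y) = 0" if j: "j \<in> {1..n}" for j
    proof -
      have "(\<Sum>y\<in>S j. T ?z y) / complex_of_real (sqrt (card (S j))) = 0"
        using orth[of 0] sw_0_psi[of _ T]
        by (intro fourier_kernel[OF n _ j, of "\<lambda>k. (\<Sum>y\<in>S k. T ?z y) / complex_of_real (sqrt (card (S k)))"]) auto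
      then show ?thesis using card_S[OF j] by simp
    qed
    have col: "(\<Sum>x\<in>S j. T x ?z) = 0" if j: "j \<in> {1..n}" for j
    proof -
      have "(\<Sum>x\<in>S j. T x ?z) / complex_of_real (sqrt (card (S j))) = 0"
        using orth[of _ 0] sw_psi_0[of _ T]
        by (intro fourier_kernel_cnj[OF n _ j, of "\<lambda>k. (\<Sum>x\<in>S k. T x ?z) / complex_of_real (sqrt (card (S k)))"]) auto
      then show ?thesis using card_S[OF j] by simp
    qed
    have block: "T x y = 0" if "x p \<noteq> y p" for x y
      unfolding T_def using p that by (rule extend_op_block)
    have translate: "T x y = T (x(p := 0)) (y(p := 0))" if "x p = y p" for x y
      unfolding T_def using p that by (rule extend_op_translate)
    have zero_row: "(\<Sum>y\<in>U. T ?z y) = 0" if "U \<in> cells d" for U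
      using S_surj[OF that] row by blast
    have zero_col: "(\<Sum>x\<in>U. T x ?z) = 0" if "U \<in> cells d" for U
      using S_surj[OF that] col by blast
    let ?u = "\<lambda>q. of_bool (q = p) :: nat"
    obtain r where r: "r \<in> {1..n}" "{?u} = S r" using S_surj[OF unit_cell] by blast
    define c where "c = sw T (\<alpha> r) (\<alpha> r)"
    have A: "sw T (\<alpha> j) (\<alpha> k) = c * of_bool (j = k)" if jk: "j \<in> {1..n}" "k \<in> {1..n}" for j k
      unfolding c_def
    proof (rule circulant_row[OF n _ r(1) _ jk])
      fix i l assume "i \<in> {1..n}" "l \<in> {1..n}" "i \<noteq> l"
      then show "(\<Sum>j=1..n. \<Sum>k=1..n. cnj (omega n ^ (i * j)) * omega n ^ (l * k) * sw T (\<alpha> j) (\<alpha> k)) = 0"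
        using orth[of i l] sw_psi_psi[of i l T] by simp
    next
      fix k assume k: "k \<in> {1..n}" "k \<noteq> r"
      have "(\<Sum>y\<in>S k. T ?u y) = 0"
        using S_inj[OF k(1) r(1) k(2)] r(2)
        by (intro unit_row[of d p T] assms(1) block translate zero_row S(1) k(1)) auto
      then show "sw T (\<alpha> r) (\<alpha> k) = 0"
        unfolding sw_alpha[OF r(1) k(1)] r(2)[symmetric] by simp
    qed
    have off: "(\<Sum>x\<in>U. \<Sum>y\<in>V. T x y) = 0" if UV: "U \<in> cells d" "V \<in> cells d" "U \<noteq> V" for U V
    proof -
      obtain j k where jk: "j \<in> {1..n}" "k \<in> {1..n}" "U = S j" "V = S k"
        using S_surj UV by metis
      moreover have "j \<noteq> k" using jk UV(3) by auto
      ultimately show ?thesis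
        using A[OF jk(1,2)] sw_alpha[OF jk(1,2), of T] card_S[OF jk(1)] card_S[OF jk(2)] by simp
    qed
    have diag: "(\<Sum>x\<in>U. \<Sum>y\<in>U. T x y) = c * of_nat (card U)" if U: "U \<in> cells d" for U
    proof -
      obtain j where j: "j \<in> {1..n}" "U = S j" using S_surj U by metis
      have "complex_of_real (sqrt (card U)) * complex_of_real (sqrt (card U)) = of_nat (card U)"
        by (simp flip: of_real_mult)
      then show ?thesis
        using A[OF j(1,1)] sw_alpha[OF j(1,1), of T] card_S[OF j(1)] j(2) by (simp add: field_simps)
    qed
    have scalar: "T x y = c * of_bool (x = y)" if "x \<in> ?L" "y \<in> ?L" for x y
      by (rule scalar_operator[of d p T]) (fact assms(1) block translate zero_row zero_col off diag that)+
    show "\<exists>c. \<forall>x\<in>labels d X. \<forall>y\<in>labels d X. E m x y = c * of_bool (x = y)"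
    proof (intro exI ballI)
      fix x y assume xy: "x \<in> labels d X" "y \<in> labels d X"
      \<comment> \<open>Labels of \<open>X\<close> are \<open>undefined\<close> elsewhere; filling
        in \<open>0\<close> gives full labels that agree off \<open>X\<close>, so that
        \<open>T\<close> at the padded labels is \<open>E m\<close>.\<close>
      define pad where "pad w q = (if q \<in> X then w q else 0)" for w :: "party label" and q
      have pad: "pad w \<in> ?L" "restrict (pad w) X = w" if "w \<in> labels d X" for w
        using that assms(1) unfolding labels_def pad_def
        by (auto simp: PiE_iff extensional_def restrict_def fun_eq_iff)
      have "restrict (pad x) (- X) = restrict (pad y) (- X)"
        by (auto simp: pad_def restrict_def)
      then have "E m x y = T (pad x) (pad y)"
        using pad xy by (simp add: T_def extend_op_def)
      also have "\<dots> = c * of_bool (pad x = pad y)"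
        using scalar pad xy by blast
      also have "pad x = pad y \<longleftrightarrow> x = y"
        using pad(2) xy by metis
      finally show "E m x y = c * of_bool (x = y)" .
    qed
  qed
  ultimately show ?thesis
    unfolding strongest_nonlocal_def n_def[symmetric] by auto
qed

end
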